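(* For all $n\geq1$, we have $$\mathcal{M}_o(n)=\sum_{i=0}^{\lfloor n/2\rfloor}(-1)^i\left[\binom{n+1-i}{i}-\binom{n-1-i}{i-2}\right]\Delta^{n-2i},$$ $$\mathcal{M}_e(n)=\sum_{i=0}^{n}(-1)^{\lceil i/2\rceil}\binom{n-\lceil i/2\rceil}{\lfloor i/2\rfloor}\Delta^{n-i},$$ $$\mathcal{M}'(n)=\sum_{i=0}^{\lfloor n/2\rfloor}(-1)^i\binom{n-i}{i}\Delta^{n-2i}.$$
   Context: $\mathcal{M}_o(n)$, $\mathcal{M}_e(n)$, $\mathcal{M}'(n)$ ($n\geq0$) are polynomials in the indeterminate $\Delta$ (which in the paper stands for the difference operator), each satisfying the recurrence $P(n+2)=\Delta P(n+1)-P(n)$ for all $n\geq0$, with initial values $\mathcal{M}_o(0)=2$, $\mathcal{M}_o(1)=\Delta$; $\mathcal{M}_e(0)=1$, $\mathcal{M}_e(1)=\Delta-1$; $\mathcal{M}'(0)=1$, $\mathcal{M}'(1)=\Delta$. Binomial coefficients $\binom{a}{b}$ with $b<0$ are $0$. *)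

theory Defs
  imports Complex_Main "HOL-Computational_Algebra.Polynomial"
begin

abbreviation Delta :: "int poly"  ("\<Delta>")
  where "\<Delta> \<equiv> [:0, 1:]"

fun M_odd :: "nat \<Rightarrow> int poly" where
  "M_odd 0 = 2"
| "M_odd (Suc 0) = \<Delta>"
| "M_odd (Suc (Suc n)) = \<Delta> * M_odd (Suc n) - M_odd n"

fun M_even :: "nat \<Rightarrow> int poly" where
  "M_even 0 = 1"
| "M_even (Suc 0) = \<Delta> - 1"
| "M_even (Suc (Suc n)) = \<Delta> * M_even (Suc n) - M_even n"

fun M_prime :: "nat \<Rightarrow> int poly" where
  "M_prime 0 = 1"
| "M_prime (Suc 0) = \<Delta>"
| "M_prime (Suc (Suc n)) = \<Delta> * M_prime (Suc n) - M_prime n"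

(* Integer arguments are used because truncated subtraction on nat would turn
   a negative lower index into 0 and so give the value 1 instead of 0.
   Only to be used with a nonnegative upper argument. *)
definition ibinom :: "int \<Rightarrow> int \<Rightarrow> int" where
  "ibinom a b = (if b < 0 then 0 else int (nat a choose nat b))"

end

theory Submission
  imports Defs
begin

text \<open>
  The three families satisfy the same second-order recurrence, so each is determined by its
  two initial values; comparing these gives
  \<open>M_odd (n + 2) = M_prime (n + 2) - M_prime n\<close> and
  \<open>M_even (n + 1) = M_prime (n + 1) - M_prime n\<close>.
  The polynomials \<open>M_prime\<close> are rescaled Chebyshev polynomials of the second kind, and their
  explicit form (\<open>M_prime_explicit\<close>) follows from the recurrence by Pascal's rule.

  The other two formulas are then read off. In the even case the two copies of \<open>M_prime\<close>
  have exponents of opposite parity and supply the terms of even and odd index respectively.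
  In the odd case they overlap, and the coefficients add up to the stated difference because
  \<open>ibinom a b - ibinom (a - 2) (b - 2) = ibinom (a - 1) b + ibinom (a - 2) (b - 1)\<close>
  for \<open>a \<ge> 2\<close>, which is Pascal's rule applied twice.
\<close>

lemma Delta_power: "\<Delta> * \<Delta> ^ k = \<Delta> ^ Suc k"
  by simp

lemma ibinom_of_nat: "ibinom (int a) (int b) = int (a choose b)"
  by (simp add: ibinom_def)

text \<open>
  The sum is first taken up to \<open>n\<close> rather than \<open>n div 2\<close>, which spares the induction a case
  distinction on the parity of \<open>n\<close>. The extra terms have a truncated exponent, but their
  binomial coefficient is zero.
\<close>
lemma M_prime_explicit_long:
  "M_prime n = (\<Sum>i\<le>n. smult ((-1) ^ i * int ((n - i) choose i)) (\<Delta> ^ (n - 2 * i)))"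
proof (induction n rule: M_prime.induct)
  case (3 n)
  \<comment> \<open>Both sides start with the leading power; the terms of index \<open>i + 1\<close> are compared.\<close>
  have shift: "\<Delta> * smult ((-1) ^ Suc i * int ((Suc n - Suc i) choose Suc i))
                   (\<Delta> ^ (Suc n - 2 * Suc i))
      = smult ((-1) ^ Suc i * int ((n - i) choose Suc i)) (\<Delta> ^ (n - 2 * i))" for i
  proof (cases "2 * i < n")
    case True
    then have "n - 2 * i = Suc (Suc n - 2 * Suc i)" by simp
    then show ?thesis by (simp only: mult_smult_right Delta_power diff_Suc_Suc)
  next
    case False
    \<comment> \<open>Here the truncated exponents do not match, but the coefficient vanishes.\<close>
    then have "(n - i) choose Suc i = 0" by (simp add: binomial_eq_0)
    then show ?thesis by simp
  qed
  have pascal: "smult ((-1) ^ Suc i * int ((Suc n - i) choose Suc i)) (\<Delta> ^ (n - 2 * i))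
      = smult ((-1) ^ Suc i * int ((n - i) choose Suc i)) (\<Delta> ^ (n - 2 * i))
        - smult ((-1) ^ i * int ((n - i) choose i)) (\<Delta> ^ (n - 2 * i))" if "i \<le> n" for i
    using that unfolding smult_diff_left[symmetric]
    by (intro arg_cong2[where f = smult] refl) (simp add: Suc_diff_le algebra_simps)
  have "(\<Sum>i\<le>Suc (Suc n). smult ((-1) ^ i * int ((Suc (Suc n) - i) choose i))
            (\<Delta> ^ (Suc (Suc n) - 2 * i)))
      = \<Delta> ^ Suc (Suc n) + (\<Sum>i\<le>Suc n. smult ((-1) ^ Suc i * int ((Suc n - i) choose Suc i))
            (\<Delta> ^ (n - 2 * i)))"
    by (subst sum.atMost_Suc_shift) simp
  also have "\<dots> = \<Delta> ^ Suc (Suc n)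
      + (\<Sum>i\<le>n. smult ((-1) ^ Suc i * int ((Suc n - i) choose Suc i)) (\<Delta> ^ (n - 2 * i)))"
    by simp
  also have "\<dots> = \<Delta> ^ Suc (Suc n)
      + (\<Sum>i\<le>n. smult ((-1) ^ Suc i * int ((n - i) choose Suc i)) (\<Delta> ^ (n - 2 * i)))
      - (\<Sum>i\<le>n. smult ((-1) ^ i * int ((n - i) choose i)) (\<Delta> ^ (n - 2 * i)))"
    by (simp add: pascal sum_subtractf del: power_Suc binomial_Suc_Suc)
  also have "\<Delta> ^ Suc (Suc n)
      + (\<Sum>i\<le>n. smult ((-1) ^ Suc i * int ((n - i) choose Suc i)) (\<Delta> ^ (n - 2 * i)))
      = \<Delta> * (\<Sum>i\<le>Suc n. smult ((-1) ^ i * int ((Suc n - i) choose i)) (\<Delta> ^ (Suc n - 2 * i)))"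
    unfolding sum.atMost_Suc_shift distrib_left sum_distrib_left shift by simp
  finally show ?case
    by (simp only: M_prime.simps(3) 3)
qed simp_all

lemma M_prime_explicit:
  "M_prime n = (\<Sum>i\<le>n div 2. smult ((-1) ^ i * int ((n - i) choose i)) (\<Delta> ^ (n - 2 * i)))"
  unfolding M_prime_explicit_long
  by (rule sum.mono_neutral_right) (auto simp: binomial_eq_0)

lemma M_odd_eq_diff: "M_odd (Suc (Suc n)) = M_prime (Suc (Suc n)) - M_prime n"
proof (induction n rule: M_prime.induct)
  case (3 n)
  have "M_odd (Suc (Suc (Suc (Suc n))))
      = \<Delta> * (M_prime (Suc (Suc (Suc n))) - M_prime (Suc n)) - (M_prime (Suc (Suc n)) - M_prime n)"
    by (simp only: M_odd.simps(3)[of "Suc (Suc n)"] 3)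
  also have "\<dots> = (\<Delta> * M_prime (Suc (Suc (Suc n))) - M_prime (Suc (Suc n)))
      - (\<Delta> * M_prime (Suc n) - M_prime n)"
    by (simp only: algebra_simps)
  finally show ?case by (simp only: M_prime.simps(3))
qed (simp_all add: numeral_poly one_pCons)

lemma M_even_eq_diff: "M_even (Suc n) = M_prime (Suc n) - M_prime n"
proof (induction n rule: M_prime.induct)
  case (3 n)
  have "M_even (Suc (Suc (Suc n)))
      = \<Delta> * (M_prime (Suc (Suc n)) - M_prime (Suc n)) - (M_prime (Suc n) - M_prime n)"
    by (simp only: M_even.simps(3)[of "Suc n"] 3)
  also have "\<dots> = (\<Delta> * M_prime (Suc (Suc n)) - M_prime (Suc n))
      - (\<Delta> * M_prime (Suc n) - M_prime n)"
    by (simp only: algebra_simps)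
  finally show ?case by (simp only: M_prime.simps(3))
qed (simp_all add: one_pCons)

lemma M_odd_explicit:
  assumes "n \<ge> 1"
  shows "M_odd n = (\<Sum>i\<le>n div 2.
           smult ((-1) ^ i * (ibinom (int n + 1 - int i) (int i)
                              - ibinom (int n - 1 - int i) (int i - 2)))
             (\<Delta> ^ (n - 2 * i)))"
proof (cases "n = 1")
  case True
  \<comment> \<open>The difference formula for \<open>M_odd\<close> only starts at 2.\<close>
  then show ?thesis by (simp add: ibinom_def)
next
  case False
  with assms obtain m where n: "n = Suc (Suc m)"
    by (metis One_nat_def not0_implies_Suc not_one_le_zero)
  let ?c = "\<lambda>i. ibinom (int n + 1 - int i) (int i) - ibinom (int n - 1 - int i) (int i - 2)"
  have c: "?c (Suc i) = int ((Suc m - i) choose Suc i) + int ((m - i) choose i)"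
    if "i \<le> m div 2" for i
  proof -
    from that have "i \<le> m" by simp
    then obtain d where d: "m = i + d" using le_Suc_ex by blast
    have e: "int n + 1 - int (Suc i) = int (Suc (Suc d))" "int n - 1 - int (Suc i) = int d"
      using d n by auto
    \<comment> \<open>For \<open>i = 0\<close> the subtracted \<open>ibinom\<close> has the lower argument -1 and vanishes.\<close>
    show ?thesis
      unfolding e using d
      by (cases i) (auto simp: ibinom_def Suc_diff_le nat_add_distrib numeral_2_eq_2)
  qed
  have "smult ((-1) ^ Suc i * ?c (Suc i)) (\<Delta> ^ (m - 2 * i))
      = smult ((-1) ^ Suc i * int ((Suc m - i) choose Suc i)) (\<Delta> ^ (m - 2 * i))
        - smult ((-1) ^ i * int ((m - i) choose i)) (\<Delta> ^ (m - 2 * i))" if "i \<le> m div 2" for i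
    unfolding c[OF that] smult_diff_left[symmetric]
    by (intro arg_cong2[where f = smult] refl) (simp add: algebra_simps del: binomial_Suc_Suc)
  then have split: "(\<Sum>i\<le>m div 2. smult ((-1) ^ Suc i * ?c (Suc i)) (\<Delta> ^ (m - 2 * i)))
      = (\<Sum>i\<le>m div 2. smult ((-1) ^ Suc i * int ((Suc m - i) choose Suc i)) (\<Delta> ^ (m - 2 * i))
          - smult ((-1) ^ i * int ((m - i) choose i)) (\<Delta> ^ (m - 2 * i)))"
    by (intro sum.cong refl) simp_all
  have "M_odd n = \<Delta> ^ n
      + (\<Sum>i\<le>m div 2. smult ((-1) ^ Suc i * int ((Suc m - i) choose Suc i)) (\<Delta> ^ (m - 2 * i)))
      - (\<Sum>i\<le>m div 2. smult ((-1) ^ i * int ((m - i) choose i)) (\<Delta> ^ (m - 2 * i)))"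
    unfolding n M_odd_eq_diff M_prime_explicit
    by (simp add: sum.atMost_Suc_shift del: sum.atMost_Suc binomial_Suc_Suc)
  also have "\<dots> = \<Delta> ^ n
      + (\<Sum>i\<le>m div 2. smult ((-1) ^ Suc i * ?c (Suc i)) (\<Delta> ^ (m - 2 * i)))"
    by (simp only: split sum_subtractf add_diff_eq)
  also have "\<dots> = (\<Sum>i\<le>n div 2. smult ((-1) ^ i * ?c i) (\<Delta> ^ (n - 2 * i)))"
  proof -
    have "?c 0 = 1" by (simp add: ibinom_def)
    moreover have "n div 2 = Suc (m div 2)" using n by simp
    ultimately show ?thesis
      by (simp add: sum.atMost_Suc_shift n del: sum.atMost_Suc)
  qed
  finally show ?thesis .
qed

text \<open>Separates the terms of even index from those of odd index.\<close>
lemma sum_split_parity: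
  fixes f :: "nat \<Rightarrow> 'a :: comm_monoid_add"
  shows "(\<Sum>i\<le>Suc n. f i) = (\<Sum>j\<le>Suc n div 2. f (2 * j)) + (\<Sum>j\<le>n div 2. f (Suc (2 * j)))"
proof (induction n)
  case (Suc n)
  show ?case
  proof (cases "even n")
    case True
    then obtain k where "n = 2 * k" by blast
    with Suc show ?thesis by (simp add: ac_simps)
  next
    case False
    then obtain k where "n = Suc (2 * k)" using oddE by fastforce
    with Suc show ?thesis by (simp add: ac_simps)
  qed
qed simp

lemma M_even_explicit:
  "M_even (Suc n) = (\<Sum>i\<le>Suc n.
     smult ((-1) ^ nat \<lceil>real i / 2\<rceil> * ibinom (int (Suc n) - \<lceil>real i / 2\<rceil>) \<lfloor>real i / 2\<rfloor>)
       (\<Delta> ^ (Suc n - i)))"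
    (is "_ = sum ?f _")
proof -
  have even: "?f (2 * j) = smult ((-1) ^ j * int ((Suc n - j) choose j)) (\<Delta> ^ (Suc n - 2 * j))"
    if "j \<le> Suc n div 2" for j
  proof -
    have "\<lceil>real (2 * j) / 2\<rceil> = int j" "\<lfloor>real (2 * j) / 2\<rfloor> = int j"
      by linarith+
    moreover have "int (Suc n) - int j = int (Suc n - j)" using that by auto
    ultimately show ?thesis by (simp only: ibinom_of_nat nat_int)
  qed
  have odd: "?f (Suc (2 * j)) = - smult ((-1) ^ j * int ((n - j) choose j)) (\<Delta> ^ (n - 2 * j))"
    if "j \<le> n div 2" for j
  proof -
    have "\<lceil>real (Suc (2 * j)) / 2\<rceil> = int (Suc j)" "\<lfloor>real (Suc (2 * j)) / 2\<rfloor> = int j"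
      by (simp_all add: ceiling_eq_iff floor_eq_iff)
    moreover have "int (Suc n) - int (Suc j) = int (n - j)" using that by auto
    moreover have "n - 2 * j = Suc n - Suc (2 * j)" by simp
    ultimately show ?thesis
      by (simp only: ibinom_of_nat nat_int power_Suc mult_minus_left mult_1 smult_minus_left)
  qed
  have "(\<Sum>j\<le>Suc n div 2. ?f (2 * j)) = M_prime (Suc n)"
    unfolding M_prime_explicit by (intro sum.cong refl even) simp
  moreover have "(\<Sum>j\<le>n div 2. ?f (Suc (2 * j))) = - M_prime n"
    unfolding M_prime_explicit sum_negf[symmetric] by (intro sum.cong refl odd) simp
  ultimately show ?thesis
    unfolding sum_split_parity[of ?f] M_even_eq_diff by (simp only: diff_conv_add_uminus)
qed

theorem theorem3p11:
  fixes n :: nat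
  assumes "n \<ge> 1"
  shows "M_odd n = (\<Sum>i = 0..nat \<lfloor>real n / 2\<rfloor>.
           smult ((-1) ^ i * (ibinom (int n + 1 - int i) (int i)
                              - ibinom (int n - 1 - int i) (int i - 2)))
             (\<Delta> ^ (n - 2 * i)))
    \<and> M_even n = (\<Sum>i = 0..n.
           smult ((-1) ^ nat \<lceil>real i / 2\<rceil> * ibinom (int n - \<lceil>real i / 2\<rceil>) \<lfloor>real i / 2\<rfloor>)
             (\<Delta> ^ (n - i)))
    \<and> M_prime n = (\<Sum>i = 0..nat \<lfloor>real n / 2\<rfloor>.
           smult ((-1) ^ i * ibinom (int n - int i) (int i))
             (\<Delta> ^ (n - 2 * i)))"
proof -
  have half: "nat \<lfloor>real n / 2\<rfloor> = n div 2" by linarith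
  have "M_prime n = (\<Sum>i\<le>n div 2. smult ((-1) ^ i * ibinom (int n - int i) (int i))
             (\<Delta> ^ (n - 2 * i)))"
    unfolding M_prime_explicit
  proof (intro sum.cong refl)
    fix i assume "i \<in> {..n div 2}"
    then have "int n - int i = int (n - i)" by auto
    then show "smult ((-1) ^ i * int ((n - i) choose i)) (\<Delta> ^ (n - 2 * i))
        = smult ((-1) ^ i * ibinom (int n - int i) (int i)) (\<Delta> ^ (n - 2 * i))"
      by (simp only: ibinom_of_nat)
  qed
  moreover obtain m where "n = Suc m" using assms by (cases n) auto
  ultimately show ?thesis
    unfolding half atLeast0AtMost using M_odd_explicit[OF assms] M_even_explicit by blast
qed

end
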